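(* Let $X$ be a coarsely geodesic, amenable bounded geometry metric space, let $n\in\mathbb{N}$, let $\tau:\mathbb{N}\to\mathbb{N}$ be a non-decreasing function, and suppose that $X$ has $FAD(n,\tau)$. Then $A_X\preceq\tau$.
   Context: Here $\mathbb{N}=\{0,1,2,\dots\}$. A metric space $X$ has bounded geometry if for all $R>0$ there is a natural number bounding the cardinality of every closed ball of radius $R$ in $X$. For $E\subseteq X$ and $R\ge 0$: $N_R(E)=\{y\in X: d(y,E)\le R\}$ and $\partial_RE=N_R(E)\setminus E$. $X$ is amenable if for all $R,\epsilon>0$ there exists a finite subset $E\subseteq X$ with $|\partial_RE|<\epsilon|E|$. $X$ is coarsely geodesic if its metric $d$ is integer valued and for all $x,y\in X$, $d(x,y)$ is the least $m\in\mathbb{N}$ for which there is a sequence $x=x_0,x_1,\dots,x_m=y$ in $X$ with $d(x_i,x_{i+1})=1$ for $i=0,\dots,m-1$. $FAD(n,\tau)$ (asymptotic dimension at most $n$ with respect to $\tau$): for all $R\in\mathbb{N}$ there exist subsets $\Omega^1,\dots,\Omega^{n+1}$ of $X$ and decompositions $\Omega^i=\bigsqcup_{j\in I_i}\Omega^i_j$ such that $X=\bigcup_{i=1}^{n+1}\Omega^i$; for each $i$ and all $j_1\ne j_2$ in $I_i$, $d(\Omega^i_{j_1},\Omega^i_{j_2})>R$; and for each $i$ and all $j\in I_i$, $\mathrm{diam}(\Omega^i_j)\le\tau(R)$. The isodiametric function $A_X:\mathbb{N}\to\mathbb{N}$ of an amenable coarsely geodesic $X$ is $A_X(k)=\min\{\mathrm{diam}(A):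 A\subseteq X \text{ finite and non-empty},\ |\partial_1A|\le\frac1k|A|\}$, where for $k=0$ the condition $|\partial_1A|\le\frac1k|A|$ is regarded as vacuous (so $A_X(0)=0$). For functions $f,g:\mathbb{N}\to\mathbb{N}$, $f\preceq g$ means there exist constants $c>0$ and a positive integer $d$ such that $f(k)\le c\,g(dk)$ for all $k\in\mathbb{N}$.
   Formalization: The formal statement also assumes that X is a single point or τ is not identically 0; without this the claim fails, e.g. for X two points at distance 1, n=1, τ=0, where A_X(2)=1. *)

theory Defs
  imports "HOL-Analysis.Analysis"
begin

context Metric_space
begin

text \<open>Distances between sets and diameters take values in \<^typ>\<open>ennreal\<close>, so that
  the distance to the empty set is \<open>\<infinity>\<close>, the diameter of an unbounded set is \<open>\<infinity>\<close>,
  and the empty set has diameter 0.\<close>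

definition set_dist :: "'a set \<Rightarrow> 'a set \<Rightarrow> ennreal" where
  "set_dist A B = (INF a\<in>A. INF b\<in>B. ennreal (d a b))"

definition set_diam :: "'a set \<Rightarrow> ennreal" where
  "set_diam A = (SUP x\<in>A. SUP y\<in>A. ennreal (d x y))"

definition set_nbhd :: "real \<Rightarrow> 'a set \<Rightarrow> 'a set" where
  "set_nbhd R E = {y \<in> M. set_dist {y} E \<le> ennreal R}"

definition bdry :: "real \<Rightarrow> 'a set \<Rightarrow> 'a set" where
  "bdry R E = set_nbhd R E - E"

definition bounded_geometry :: bool where
  "bounded_geometry \<longleftrightarrow>
     (\<forall>R>0. \<exists>N::nat. \<forall>x\<in>M. finite (mcball x R) \<and> card (mcball x R) \<le> N)"

text \<open>Finiteness of the boundary is required explicitly, here and in \<open>isodiam\<close> below,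
  because \<^const>\<open>card\<close> is 0 on infinite sets; it is automatic in bounded geometry.\<close>

definition amenable :: bool where
  "amenable \<longleftrightarrow>
     (\<forall>R>0. \<forall>\<epsilon>>0. \<exists>E\<subseteq>M. finite E \<and> finite (bdry R E) \<and>
        real (card (bdry R E)) < \<epsilon> * real (card E))"

definition unit_path :: "'a \<Rightarrow> 'a \<Rightarrow> nat \<Rightarrow> bool" where
  "unit_path x y m \<longleftrightarrow>
     (\<exists>s::nat \<Rightarrow> 'a. s 0 = x \<and> s m = y \<and> (\<forall>i\<le>m. s i \<in> M) \<and> (\<forall>i<m. d (s i) (s (Suc i)) = 1))"

definition coarsely_geodesic :: bool where
  "coarsely_geodesic \<longleftrightarrow>
     (\<forall>x\<in>M. \<forall>y\<in>M. d x y \<in> \<int>) \<and>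
     (\<forall>x\<in>M. \<forall>y\<in>M. (\<exists>m. unit_path x y m) \<and> d x y = real (LEAST m. unit_path x y m))"

text \<open>The decomposition of \<open>\<Omega> i\<close> is given as the collection \<open>P i\<close> of its pieces
  instead of as an indexed family. As the pieces of a decomposition are disjoint, only
  repetitions of the empty set are lost.\<close>

definition FAD :: "nat \<Rightarrow> (nat \<Rightarrow> nat) \<Rightarrow> bool" where
  "FAD n \<tau> \<longleftrightarrow>
     (\<forall>R::nat. \<exists>(\<Omega> :: nat \<Rightarrow> 'a set) (P :: nat \<Rightarrow> 'a set set).
        M = (\<Union>i\<in>{1..n+1}. \<Omega> i) \<and>
        (\<forall>i\<in>{1..n+1}.
           \<Omega> i = \<Union> (P i) \<and> pairwise disjnt (P i) \<and>
           (\<forall>U\<in>P i. \<forall>V\<in>P i. U \<noteq> V \<longrightarrow> set_dist U V > of_nat R) \<and>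
           (\<forall>U\<in>P i. set_diam U \<le> of_nat (\<tau> R))))"

text \<open>In an amenable coarsely geodesic space the minimum exists, since diameters of finite
  sets are then natural numbers. The condition on the boundary is void for \<open>k = 0\<close>.\<close>

definition isodiam :: "nat \<Rightarrow> nat" where
  "isodiam k =
     (LEAST m::nat. \<exists>A\<subseteq>M. finite A \<and> A \<noteq> {} \<and> set_diam A = of_nat m \<and>
        (k > 0 \<longrightarrow> finite (bdry 1 A) \<and> real (card (bdry 1 A)) \<le> 1 / real k * real (card A)))"

end

definition growth_le :: "(nat \<Rightarrow> nat) \<Rightarrow> (nat \<Rightarrow> nat) \<Rightarrow> bool" (infix "\<preceq>" 50) where
  "f \<preceq> g \<longleftrightarrow> (\<exists>c::real. c > 0 \<and> (\<exists>q::nat. q > 0 \<and> (\<forall>k. real (f k) \<le> c * real (g (q * k)))))"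

end

theory Submission
  imports Defs
begin

text \<open>Let \<open>r = 2 (n + 1) k\<close>, take the pieces provided by \<open>FAD\<close> at scale \<open>2 r\<close>, and let \<open>E\<close>
  be a finite set with \<open>|\<partial>\<^sub>1 E| < |E| / r\<close>. Each \<open>x \<in> E\<close> lies in at least \<open>r\<close> of the sets
  \<open>N\<^sub>s(U) \<inter> E\<close> with \<open>U\<close> a piece and \<open>s < r\<close>. On the other hand, for a fixed colour
  the neighbourhoods \<open>N\<^sub>r(U)\<close> are disjoint, so a point of \<open>E\<close> lies in the 1-boundary of at most
  one of the sets of that colour and a point of \<open>\<partial>\<^sub>1 E\<close> in the 1-boundary of at most \<open>r\<close> of them.
  Double counting shows that one of these sets has a boundary of relative size at most \<open>1 / k\<close>;
  its diameter is at most \<open>\<tau> (2 r) + 2 r\<close>. The term \<open>2 r\<close> is absorbed because \<open>\<tau>\<close> grows at least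
  linearly when \<open>X\<close> is infinite: along a geodesic segment of length \<open>R\<close> each colour contributes
  only one piece. When \<open>X\<close> is finite, \<open>A = X\<close> has empty boundary.\<close>

context Metric_space
begin

section \<open>Set distances, diameters and boundaries in terms of points\<close>

lemma set_dist_le_dist: "u \<in> U \<Longrightarrow> v \<in> V \<Longrightarrow> set_dist U V \<le> ennreal (d u v)"
  unfolding set_dist_def by (meson INF_lower2 order_refl)

lemma dist_gt_set_dist:
  assumes "set_dist U V > of_nat R" "u \<in> U" "v \<in> V"
  shows "d u v > real R"
proof -
  have "ennreal (real R) < ennreal (d u v)"
    using assms set_dist_le_dist[of u U v V] by (simp add: ennreal_of_nat_eq_real_of_nat order_less_le_trans)
  then show ?thesis
    by (simp add: ennreal_less_iff)
qed

lemma dist_le_set_diam: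
  assumes "set_diam U \<le> of_nat D" "u \<in> U" "v \<in> U"
  shows "d u v \<le> real D"
proof -
  have "ennreal (d u v) \<le> set_diam U"
    unfolding set_diam_def using assms(2,3) by (meson SUP_upper2 order_refl)
  with assms(1) have "ennreal (d u v) \<le> ennreal (real D)"
    unfolding ennreal_of_nat_eq_real_of_nat by order
  then show ?thesis by (simp add: ennreal_le_iff)
qed

lemma coarsely_geodesic_dist_nat:
  assumes "coarsely_geodesic" "x \<in> M" "y \<in> M"
  obtains m :: nat where "d x y = real m"
  using assms unfolding coarsely_geodesic_def by blast

lemma FAD_pieces:
  assumes "FAD n \<tau>"
  obtains P :: "nat \<Rightarrow> 'a set set" where "M = (\<Union>i\<in>{1..n+1}. \<Union> (P i))"
    "\<And>i U V u v. \<lbrakk>i \<in> {1..n+1}; U \<in> P i; V \<in> P i; U \<noteq> V; u \<in> U; v \<in> V\<rbrakk> \<Longrightarrow> d u v > real R"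
    "\<And>i U u v. \<lbrakk>i \<in> {1..n+1}; U \<in> P i; u \<in> U; v \<in> U\<rbrakk> \<Longrightarrow> d u v \<le> real (\<tau> R)"
proof -
  obtain \<Omega> P where M: "M = (\<Union>i\<in>{1..n+1}. \<Omega> i)"
    and P: "\<forall>i\<in>{1..n+1}. \<Omega> i = \<Union> (P i) \<and> pairwise disjnt (P i) \<and>
      (\<forall>U\<in>P i. \<forall>V\<in>P i. U \<noteq> V \<longrightarrow> set_dist U V > of_nat R) \<and>
      (\<forall>U\<in>P i. set_diam U \<le> of_nat (\<tau> R))"
    using spec[OF assms[unfolded FAD_def], of R] by (elim exE conjE)
  show thesis
  proof (rule that)
    show "M = (\<Union>i\<in>{1..n+1}. \<Union> (P i))" using M P by simp
  next
    fix i U V u v assume "i \<in> {1..n+1}" "U \<in> P i" "V \<in> P i" "U \<noteq> V" "u \<in> U" "v \<in> V"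
    then show "d u v > real R" using P by (intro dist_gt_set_dist[of R U V]) auto
  next
    fix i U u v assume "i \<in> {1..n+1}" "U \<in> P i" "u \<in> U" "v \<in> U"
    then show "d u v \<le> real (\<tau> R)" using P by (intro dist_le_set_diam[of U]) auto
  qed
qed

text \<open>Integrality of the metric replaces compactness: an infimum of at most \<open>s\<close>
  gives a point of \<open>U\<close> at distance less than \<open>s + 1\<close>, hence at most
  \<open>s\<close>.\<close>

lemma mem_set_nbhd_iff:
  assumes cg: "coarsely_geodesic" and U: "U \<subseteq> M"
  shows "y \<in> set_nbhd (real s) U \<longleftrightarrow> y \<in> M \<and> (\<exists>u\<in>U. d y u \<le> real s)"
proof
  assume y: "y \<in> set_nbhd (real s) U"
  then have yM: "y \<in> M" and "set_dist {y} U \<le> ennreal (real s)"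
    by (auto simp: set_nbhd_def)
  then have "(INF u\<in>U. ennreal (d y u)) < ennreal (real s + 1)"
    by (simp add: set_dist_def ennreal_lessI order_le_less_trans)
  then obtain u where u: "u \<in> U" "ennreal (d y u) < ennreal (real s + 1)"
    by (auto simp: INF_less_iff)
  then have "d y u < real s + 1" by (simp add: ennreal_less_iff del: ennreal_plus)
  moreover obtain m where "d y u = real m"
    using coarsely_geodesic_dist_nat[OF cg yM] u(1) U by blast
  ultimately have "d y u \<le> real s" by simp
  with yM u show "y \<in> M \<and> (\<exists>u\<in>U. d y u \<le> real s)" by blast
next
  assume "y \<in> M \<and> (\<exists>u\<in>U. d y u \<le> real s)"
  then obtain u where u: "y \<in> M" "u \<in> U" "d y u \<le> real s" by blast
  then have "set_dist {y} U \<le> ennreal (real s)"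
    using set_dist_le_dist[of y "{y}" u U] by (meson ennreal_leI order_trans singletonI)
  with u show "y \<in> set_nbhd (real s) U" by (simp add: set_nbhd_def)
qed

lemma mem_bdry_one_iff:
  assumes "coarsely_geodesic" "U \<subseteq> M"
  shows "y \<in> bdry 1 U \<longleftrightarrow> y \<in> M \<and> y \<notin> U \<and> (\<exists>u\<in>U. d y u \<le> 1)"
  using mem_set_nbhd_iff[OF assms, of y 1] by (auto simp: bdry_def)

lemma set_nbhd_mono:
  assumes "s \<le> t"
  shows "set_nbhd s U \<subseteq> set_nbhd t U"
  using assms by (auto simp: set_nbhd_def intro: order_trans ennreal_leI)

section \<open>Upper bounds for the isodiametric function\<close>

text \<open>The largest of the finitely many distances is attained, so the diameter is a natural
  number, as the minimum in \<open>isodiam\<close> requires.\<close>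

lemma set_diam_finite:
  assumes cg: "coarsely_geodesic" and A: "A \<subseteq> M" "finite A" "A \<noteq> {}"
    and D: "\<And>x y. x \<in> A \<Longrightarrow> y \<in> A \<Longrightarrow> d x y \<le> real D"
  obtains m where "m \<le> D" "set_diam A = of_nat m"
proof -
  let ?S = "(\<lambda>(x, y). d x y) ` (A \<times> A)"
  have "finite ?S" "?S \<noteq> {}" using A by auto
  then have "Max ?S \<in> ?S" by (rule Max_in)
  then obtain a b where ab: "a \<in> A" "b \<in> A" "Max ?S = d a b" by auto
  have max: "d x y \<le> d a b" if "x \<in> A" "y \<in> A" for x y
    using that A(2) unfolding ab(3)[symmetric] by (intro Max_ge) auto
  obtain m where m: "d a b = real m"
    using coarsely_geodesic_dist_nat[OF cg] ab A by blast
  have "set_diam A = ennreal (d a b)"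
    unfolding set_diam_def
  proof (rule antisym)
    show "(SUP x\<in>A. SUP y\<in>A. ennreal (d x y)) \<le> ennreal (d a b)"
      using max by (intro SUP_least ennreal_leI)
    show "ennreal (d a b) \<le> (SUP x\<in>A. SUP y\<in>A. ennreal (d x y))"
      using ab by (meson SUP_upper2 order_refl)
  qed
  moreover have "m \<le> D" using D[OF ab(1,2)] m by simp
  ultimately show ?thesis
    using that m by (simp add: ennreal_of_nat_eq_real_of_nat)
qed

text \<open>All upper bounds on \<open>isodiam\<close> come from this: one admissible set suffices,
  and \<open>D\<close> need only bound its distances.\<close>

lemma isodiam_le:
  assumes "coarsely_geodesic" "A \<subseteq> M" "finite A" "A \<noteq> {}"
    and "\<And>x y. x \<in> A \<Longrightarrow> y \<in> A \<Longrightarrow> d x y \<le> real D"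
    and "k > 0 \<Longrightarrow> finite (bdry 1 A) \<and> real (card (bdry 1 A)) \<le> 1 / real k * real (card A)"
  shows "isodiam k \<le> D"
proof -
  obtain m where m: "m \<le> D" "set_diam A = of_nat m"
    using set_diam_finite[OF assms(1-5)] by blast
  have "isodiam k \<le> m"
    unfolding isodiam_def using assms m by (intro Least_le exI[of _ A]) auto
  with m show ?thesis by simp
qed

text \<open>A single point is admissible because the boundary condition is void. The case
  \<open>k = 0\<close> is treated apart since \<open>\<tau> 0\<close> may vanish.\<close>

lemma isodiam_0:
  assumes "coarsely_geodesic" "M \<noteq> {}"
  shows "isodiam 0 = 0"
proof -
  obtain x where "x \<in> M" using assms by auto
  then have "isodiam 0 \<le> 0"
    using isodiam_le[OF assms(1), of "{x}" 0 0] by simp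
  then show ?thesis by simp
qed

lemma isodiam_le_diam_finite_space:
  assumes "coarsely_geodesic" "finite M" "M \<noteq> {}"
    and "\<And>x y. x \<in> M \<Longrightarrow> y \<in> M \<Longrightarrow> d x y \<le> real D"
  shows "isodiam k \<le> D"
proof -
  have "bdry 1 M = {}" by (auto simp: bdry_def set_nbhd_def)
  then show ?thesis using assms by (intro isodiam_le[of M]) auto
qed

section \<open>Linear growth of \<open>\<tau>\<close> on infinite spaces\<close>

text \<open>Finite balls make an infinite space unbounded, and subpaths of a shortest unit path are
  again shortest.\<close>

lemma geodesic_segment:
  assumes cg: "coarsely_geodesic" and bg: "bounded_geometry" and inf: "infinite M"
  obtains s :: "nat \<Rightarrow> 'a" where "\<And>i. i \<le> L \<Longrightarrow> s i \<in> M"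
    "\<And>i j. i \<le> j \<Longrightarrow> j \<le> L \<Longrightarrow> d (s i) (s j) = real (j - i)"
proof -
  obtain x where x: "x \<in> M" using inf by fastforce
  \<comment> \<open>The radius is \<open>Suc L\<close> because bounded geometry speaks only of
    positive radii and \<open>L\<close> may be 0.\<close>
  have "real (Suc L) > 0" by simp
  then have "finite (mcball x (real (Suc L)))"
    using bg x unfolding bounded_geometry_def by blast
  then obtain y where y: "y \<in> M" "y \<notin> mcball x (real (Suc L))"
    using inf by (meson infinite_super subsetI)
  then have far: "d x y > real L" using x by auto
  define m where "m = (LEAST m. unit_path x y m)"
  have dm: "d x y = real m" and "unit_path x y m"
    using cg x y unfolding coarsely_geodesic_def m_def by (auto intro: LeastI_ex)
  then obtain s where s: "s 0 = x" "s m = y" "\<And>i. i \<le> m \<Longrightarrow> s i \<in> M"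
    "\<And>i. i < m \<Longrightarrow> d (s i) (s (Suc i)) = 1"
    unfolding unit_path_def by blast
  have le: "d (s i) (s j) \<le> real (j - i)" if "i \<le> j" "j \<le> m" for i j
    using that
  proof (induction j rule: dec_induct)
    case base
    then show ?case using s(3) by simp
  next
    case (step j)
    then have "d (s i) (s (Suc j)) \<le> d (s i) (s j) + d (s j) (s (Suc j))"
      using s(3) by (intro triangle) auto
    with step s(4)[of j] show ?case by (simp add: Suc_diff_le)
  qed
  have "L \<le> m" using far dm by simp
  show thesis
  proof (rule that)
    fix i assume "i \<le> L"
    then show "s i \<in> M" using s(3) \<open>L \<le> m\<close> by simp
  next
    fix i j assume ij: "i \<le> j" "j \<le> L"
    then have jm: "j \<le> m" using \<open>L \<le> m\<close> by simp
    have M: "s i \<in> M" "s j \<in> M" "s 0 \<in> M" "s m \<in> M" using ij jm s(3) by auto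
    \<comment> \<open>A shortcut from \<open>s i\<close> to \<open>s j\<close> would make the whole
      path shorter than \<open>m\<close>; with \<open>le\<close> on the three subpaths, equality
      follows.\<close>
    have "real m \<le> d (s 0) (s i) + d (s i) (s j) + d (s j) (s m)"
      using triangle[of "s 0" "s i" "s m"] triangle[of "s i" "s j" "s m"] M dm s(1,2) by simp
    with le[of 0 i] le[of i j] le[of j m] ij jm
    show "d (s i) (s j) = real (j - i)" by (simp add: of_nat_diff)
  qed
qed

text \<open>The \<open>R + 1\<close> points of a segment are at mutual distance at most
  \<open>R\<close>, so one colour meets them in a single piece, whose diameter allows at most
  \<open>\<tau> R + 1\<close> of them.\<close>

lemma FAD_linear_lower_bound:
  assumes cg: "coarsely_geodesic" and bg: "bounded_geometry" and inf: "infinite M"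
    and "FAD n \<tau>"
  shows "R + 1 \<le> (n + 1) * (\<tau> R + 1)"
proof -
  obtain P where cover: "M = (\<Union>i\<in>{1..n+1}. \<Union> (P i))"
    and sep: "\<And>i U V u v. \<lbrakk>i \<in> {1..n+1}; U \<in> P i; V \<in> P i; U \<noteq> V; u \<in> U; v \<in> V\<rbrakk> \<Longrightarrow> d u v > real R"
    and diam: "\<And>i U u v. \<lbrakk>i \<in> {1..n+1}; U \<in> P i; u \<in> U; v \<in> U\<rbrakk> \<Longrightarrow> d u v \<le> real (\<tau> R)"
    using FAD_pieces[OF assms(4), of R] by blast
  obtain s where s: "\<And>i. i \<le> R \<Longrightarrow> s i \<in> M"
    "\<And>i j. i \<le> j \<Longrightarrow> j \<le> R \<Longrightarrow> d (s i) (s j) = real (j - i)"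
    using geodesic_segment[OF cg bg inf, where L = R] by blast
  define C where "C i = {j \<in> {..R}. s j \<in> \<Union> (P i)}" for i
  have C: "card (C i) \<le> \<tau> R + 1" if i: "i \<in> {1..n+1}" for i
  proof (cases "C i = {}")
    case False
    have fin: "finite (C i)" by (simp add: C_def)
    \<comment> \<open>Measured from the least index, the diameter bound confines all indices of
      colour \<open>i\<close> to a window of \<open>\<tau> R + 1\<close> integers.\<close>
    define a where "a = Min (C i)"
    have a: "a \<in> C i" and min: "\<And>j. j \<in> C i \<Longrightarrow> a \<le> j"
      using fin False by (auto simp: a_def)
    have "j \<in> {a..a + \<tau> R}" if j: "j \<in> C i" for j
    proof -
      have aj: "a \<le> j" "j \<le> R" using min j by (auto simp: C_def)
      obtain U V where UV: "U \<in> P i" "V \<in> P i" "s a \<in> U" "s j \<in> V"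
        using a j by (auto simp: C_def)
      have "U = V"
      proof (rule ccontr)
        assume "U \<noteq> V"
        then have "d (s a) (s j) > real R"
          using sep[OF i UV(1,2)] UV(3,4) by blast
        with s(2)[OF aj] aj show False by simp
      qed
      then have "d (s a) (s j) \<le> real (\<tau> R)"
        using diam[OF i UV(1)] UV by blast
      with s(2)[OF aj] aj show ?thesis by simp
    qed
    then have "card (C i) \<le> card {a..a + \<tau> R}" by (intro card_mono) auto
    then show ?thesis by simp
  qed simp
  have "{..R} \<subseteq> (\<Union>i\<in>{1..n+1}. C i)"
    using s(1) cover by (force simp: C_def)
  then have "card {..R} \<le> card (\<Union>i\<in>{1..n+1}. C i)"
    by (intro card_mono) (auto simp: C_def)
  also have "\<dots> \<le> (\<Sum>i\<in>{1..n+1}. card (C i))" by (rule card_UN_le) simp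
  also have "\<dots> \<le> (\<Sum>i\<in>{1..n+1}. \<tau> R + 1)" using C by (rule sum_mono)
  finally show ?thesis by simp
qed

end

section \<open>Double counting and the choice of a Folner piece\<close>

lemma sum_card_double_count:
  assumes "finite T" "finite Y" "\<And>t. t \<in> T \<Longrightarrow> A t \<subseteq> Y"
  shows "(\<Sum>t\<in>T. card (A t)) = (\<Sum>y\<in>Y. card {t \<in> T. y \<in> A t})"
proof -
  have "(\<Sum>t\<in>T. card (A t)) = (\<Sum>t\<in>T. \<Sum>y\<in>Y. if y \<in> A t then 1 else 0)"
  proof (rule sum.cong)
    fix t assume "t \<in> T"
    then have "A t = Y \<inter> {y. y \<in> A t}" using assms by auto
    then have "card (A t) = card (Y \<inter> {y. y \<in> A t})" by simp
    then show "card (A t) = (\<Sum>y\<in>Y. if y \<in> A t then 1 else 0)"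
      using assms(2) by (simp add: sum.If_cases)
  qed simp
  also have "\<dots> = (\<Sum>y\<in>Y. \<Sum>t\<in>T. if y \<in> A t then 1 else 0)" by (rule sum.swap)
  also have "\<dots> = (\<Sum>y\<in>Y. card {t \<in> T. y \<in> A t})"
    using assms(1) by (simp add: sum.If_cases Int_def)
  finally show ?thesis .
qed

context Metric_space
begin

text \<open>The factor 2 in the bound on \<open>r\<close> pays for two contributions to the
  boundaries: points of \<open>E\<close> give at most \<open>(n + 1) * card E\<close>, and points of
  \<open>bdry 1 E\<close> at most \<open>(n + 1) * r * card (bdry 1 E)\<close>, which
  \<open>E_bdry\<close> bounds by the same quantity.\<close>

lemma exists_Folner_piece:
  assumes cg: "coarsely_geodesic" and E: "E \<subseteq> M" "finite E" "finite (bdry 1 E)"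
    and E_bdry: "r * card (bdry 1 E) < card E"
    and r: "2 * (n + 1) * k \<le> r" "r > 0"
    and cover: "M = (\<Union>i\<in>{1..n+1}. \<Union> (P i))"
    and sep: "\<And>i U V u v. \<lbrakk>i \<in> {1..n+1}; U \<in> P i; V \<in> P i; U \<noteq> V; u \<in> U; v \<in> V\<rbrakk>
      \<Longrightarrow> d u v > real (2 * r)"
  obtains i U s where "i \<in> {1..n+1}" "U \<in> P i" "s < r" "set_nbhd (real s) U \<inter> E \<noteq> {}"
    "finite (bdry 1 (set_nbhd (real s) U \<inter> E))"
    "k * card (bdry 1 (set_nbhd (real s) U \<inter> E)) \<le> card (set_nbhd (real s) U \<inter> E)"
proof -
  have UM: "U \<subseteq> M" if "i \<in> {1..n+1}" "U \<in> P i" for i U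
    using that cover by blast
  have nb: "y \<in> set_nbhd (real s) U \<longleftrightarrow> y \<in> M \<and> (\<exists>u\<in>U. d y u \<le> real s)"
    if "i \<in> {1..n+1}" "U \<in> P i" for i U y s
    using mem_set_nbhd_iff[OF cg UM[OF that]] .
  have uniq: "U = V" if iUV: "i \<in> {1..n+1}" "U \<in> P i" "V \<in> P i"
    and y: "y \<in> set_nbhd (real s) U" "y \<in> set_nbhd (real t) V" and "s \<le> r" "t \<le> r" for i U V y s t
  proof (rule ccontr)
    assume "U \<noteq> V"
    obtain u v where uv: "y \<in> M" "u \<in> U" "v \<in> V" "d y u \<le> real s" "d y v \<le> real t"
      using y nb[OF iUV(1,2)] nb[OF iUV(1,3)] by blast
    then have "d u v \<le> d y u + d y v"
      using UM iUV by (metis commute subsetD triangle)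
    moreover have "d u v > real (2 * r)"
      using sep iUV \<open>U \<noteq> V\<close> uv by blast
    ultimately show False using uv that by linarith
  qed
  define A :: "nat \<times> 'a set \<times> nat \<Rightarrow> 'a set" where "A = (\<lambda>(i, U, s). set_nbhd (real s) U \<inter> E)"
  \<comment> \<open>Triples are counted, not sets, since different \<open>s\<close> may give the
    same set. Nonempty intersections make every triple a candidate and, with \<open>fin_i\<close>,
    make \<open>T\<close> finite.\<close>
  define T where "T = {(i, U, s) | i U s. i \<in> {1..n+1} \<and> U \<in> P i \<and> s < r \<and>
    set_nbhd (real s) U \<inter> E \<noteq> {}}"
  define Y where "Y = E \<union> bdry 1 E"
  have AM: "A t \<subseteq> M" "A t \<subseteq> E" for t
    using E(1) by (auto simp: A_def split: prod.splits)
  have finY: "finite Y" using E by (simp add: Y_def)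
  have bY: "bdry 1 (A t) \<subseteq> Y" for t
    using AM[of t] E(1) by (fastforce simp: mem_bdry_one_iff[OF cg] Y_def)
  \<comment> \<open>There may be infinitely many pieces, but by \<open>uniq\<close> each point of
    \<open>E\<close> is within \<open>r\<close> of at most one of each colour.\<close>
  have fin_i: "finite {U \<in> P i. set_nbhd (real r) U \<inter> E \<noteq> {}}" if i: "i \<in> {1..n+1}" for i
  proof (rule finite_subset)
    show "{U \<in> P i. set_nbhd (real r) U \<inter> E \<noteq> {}} \<subseteq>
        (\<Union>e\<in>E. {U \<in> P i. e \<in> set_nbhd (real r) U})" by auto
    have "finite {U \<in> P i. e \<in> set_nbhd (real r) U}" for e
    proof (cases "{U \<in> P i. e \<in> set_nbhd (real r) U} = {}")
      case False
      then obtain V where V: "V \<in> P i" "e \<in> set_nbhd (real r) V" by blast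
      have "U = V" if "U \<in> P i" "e \<in> set_nbhd (real r) U" for U
        using uniq[OF i that(1) V(1) that(2) V(2)] by simp
      then have "{U \<in> P i. e \<in> set_nbhd (real r) U} \<subseteq> {V}" by auto
      then show ?thesis using finite_subset by blast
    qed (metis finite.emptyI)
    then show "finite (\<Union>e\<in>E. {U \<in> P i. e \<in> set_nbhd (real r) U})" using E by simp
  qed
  have finT: "finite T"
  proof (rule finite_subset)
    show "T \<subseteq> Sigma {1..n+1} (\<lambda>i. {U \<in> P i. set_nbhd (real r) U \<inter> E \<noteq> {}} \<times> {..<r})"
    proof
      fix t assume "t \<in> T"
      then obtain i U s where t: "t = (i, U, s)" "i \<in> {1..n+1}" "U \<in> P i" "s < r"
        "set_nbhd (real s) U \<inter> E \<noteq> {}"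
        by (auto simp: T_def)
      moreover have "set_nbhd (real s) U \<subseteq> set_nbhd (real r) U"
        using t(4) by (intro set_nbhd_mono) simp
      ultimately show "t \<in> Sigma {1..n+1}
          (\<lambda>i. {U \<in> P i. set_nbhd (real r) U \<inter> E \<noteq> {}} \<times> {..<r})"
        by blast
    qed
    show "finite (Sigma {1..n+1} (\<lambda>i. {U \<in> P i. set_nbhd (real r) U \<inter> E \<noteq> {}} \<times> {..<r}))"
      using fin_i by (intro finite_SigmaI finite_cartesian_product) auto
  qed
  have near: "y \<in> set_nbhd (real (Suc s)) U"
    if iU: "i \<in> {1..n+1}" "U \<in> P i" and y: "y \<in> bdry 1 (A (i, U, s))" for i U s y
  proof -
    obtain e where e: "y \<in> M" "e \<in> set_nbhd (real s) U" "d y e \<le> 1"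
      using y AM by (auto simp: mem_bdry_one_iff[OF cg] A_def)
    then obtain u where "u \<in> U" "e \<in> M" "d e u \<le> real s" using nb[OF iU] by blast
    then show ?thesis
      using e UM[OF iU] triangle[of y e u] by (subst nb[OF iU]) force
  qed
  \<comment> \<open>The piece containing \<open>y\<close> contributes one triple for each
    \<open>s < r\<close>.\<close>
  have lower: "r \<le> card {t \<in> T. y \<in> A t}" if y: "y \<in> E" for y
  proof -
    obtain i U where iU: "i \<in> {1..n+1}" "U \<in> P i" "y \<in> U"
      using y E(1) cover by blast
    then have "y \<in> set_nbhd (real s) U" for s
      using UM[OF iU(1,2)] mdist_zero[of y] nb[OF iU(1,2)] by force
    then have "set_nbhd (real s) U \<inter> E \<noteq> {} \<and> y \<in> set_nbhd (real s) U" for s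
      using y by blast
    then have "(\<lambda>s. (i, U, s)) ` {..<r} \<subseteq> {t \<in> T. y \<in> A t}"
      using iU y by (auto simp: T_def A_def)
    then have "card ((\<lambda>s. (i, U, s)) ` {..<r}) \<le> card {t \<in> T. y \<in> A t}"
      using finT by (intro card_mono) auto
    moreover have "card ((\<lambda>s. (i, U, s)) ` {..<r}) = r"
      by (subst card_image) (auto simp: inj_on_def)
    ultimately show ?thesis by simp
  qed
  \<comment> \<open>The colour determines \<open>U\<close> by \<open>uniq\<close>. As
    \<open>y\<close> is in \<open>E\<close> but not in the truncated set, it lies outside the
    neighbourhood of radius \<open>s\<close> and inside that of radius \<open>Suc s\<close>, which
    determines \<open>s\<close>.\<close>
  have upper_E: "card {t \<in> T. y \<in> bdry 1 (A t)} \<le> n + 1" if y: "y \<in> E" for y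
  proof -
    have "inj_on fst {t \<in> T. y \<in> bdry 1 (A t)}"
    proof (rule inj_onI, clarsimp simp: T_def)
      fix i U s V t
      assume i: "Suc 0 \<le> i" "i \<le> Suc n" and "U \<in> P i" "s < r" "V \<in> P i" "t < r"
        and b: "y \<in> bdry 1 (A (i, U, s))" "y \<in> bdry 1 (A (i, V, t))"
      have i: "i \<in> {1..n+1}" using i by simp
      have nr: "y \<in> set_nbhd (real (Suc s)) U" "y \<in> set_nbhd (real (Suc t)) V"
        using near i \<open>U \<in> P i\<close> \<open>V \<in> P i\<close> b by auto
      then have "U = V"
        using uniq[OF i \<open>U \<in> P i\<close> \<open>V \<in> P i\<close>] \<open>s < r\<close> \<open>t < r\<close> Suc_leI by blast
      have nin: "y \<notin> set_nbhd (real s) U" "y \<notin> set_nbhd (real t) U"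
        using b y \<open>U = V\<close> by (auto simp: bdry_def A_def)
      have "\<not> s < t" "\<not> t < s"
        using nr nin \<open>U = V\<close> set_nbhd_mono[of "real (Suc s)" "real t" U]
          set_nbhd_mono[of "real (Suc t)" "real s" U] by auto
      with \<open>U = V\<close> show "U = V \<and> s = t" by simp
    qed
    moreover have "fst ` {t \<in> T. y \<in> bdry 1 (A t)} \<subseteq> {1..n+1}" by (auto simp: T_def)
    ultimately have "card {t \<in> T. y \<in> bdry 1 (A t)} \<le> card {1..n+1}"
      by (rule card_inj_on_le) simp
    then show ?thesis by simp
  qed
  \<comment> \<open>Outside \<open>E\<close> the truncation hides the radius, so only
    \<open>U\<close> is determined, by \<open>i\<close> and \<open>s\<close>; this costs a factor
    \<open>r\<close>.\<close>
  have upper_bdry: "card {t \<in> T. y \<in> bdry 1 (A t)} \<le> (n + 1) * r" for y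
  proof -
    have "inj_on (\<lambda>(i, U, s). (i, s)) {t \<in> T. y \<in> bdry 1 (A t)}"
    proof (rule inj_onI, clarsimp simp: T_def)
      fix i U s V
      assume i: "Suc 0 \<le> i" "i \<le> Suc n" and "U \<in> P i" "s < r" "V \<in> P i"
        and b: "y \<in> bdry 1 (A (i, U, s))" "y \<in> bdry 1 (A (i, V, s))"
      have i: "i \<in> {1..n+1}" using i by simp
      have "y \<in> set_nbhd (real (Suc s)) U" "y \<in> set_nbhd (real (Suc s)) V"
        using near i \<open>U \<in> P i\<close> \<open>V \<in> P i\<close> b by auto
      then show "U = V"
        using uniq[OF i \<open>U \<in> P i\<close> \<open>V \<in> P i\<close>] \<open>s < r\<close> Suc_leI by blast
    qed
    moreover have "(\<lambda>(i, U, s). (i, s)) ` {t \<in> T. y \<in> bdry 1 (A t)} \<subseteq> {1..n+1} \<times> {..<r}"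
      by (auto simp: T_def)
    ultimately have "card {t \<in> T. y \<in> bdry 1 (A t)} \<le> card ({1..n+1} \<times> {..<r})"
      by (rule card_inj_on_le) simp
    then show ?thesis by simp
  qed
  have disj: "E \<inter> bdry 1 E = {}" by (auto simp: bdry_def)
  have "(\<Sum>t\<in>T. card (bdry 1 (A t))) = (\<Sum>y\<in>Y. card {t \<in> T. y \<in> bdry 1 (A t)})"
    by (rule sum_card_double_count[OF finT finY bY])
  also have "\<dots> = (\<Sum>y\<in>E. card {t \<in> T. y \<in> bdry 1 (A t)})
      + (\<Sum>y\<in>bdry 1 E. card {t \<in> T. y \<in> bdry 1 (A t)})"
    unfolding Y_def using E disj by (intro sum.union_disjoint)
  also have "\<dots> \<le> (\<Sum>y\<in>E. n + 1) + (\<Sum>y\<in>bdry 1 E. (n + 1) * r)"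
    by (intro add_mono sum_mono upper_E upper_bdry)
  also have "\<dots> = (n + 1) * (card E + r * card (bdry 1 E))"
    by (simp add: algebra_simps)
  also have "\<dots> \<le> (n + 1) * (2 * card E)"
    using E_bdry by (intro mult_le_mono2) simp
  finally have "k * (\<Sum>t\<in>T. card (bdry 1 (A t))) \<le> k * ((n + 1) * (2 * card E))"
    by (rule mult_le_mono2)
  also have "\<dots> = (2 * (n + 1) * k) * card E" by (simp add: algebra_simps)
  also have "\<dots> \<le> r * card E" using r(1) by (rule mult_le_mono1)
  also have "\<dots> = (\<Sum>y\<in>E. r)" by simp
  also have "\<dots> \<le> (\<Sum>y\<in>E. card {t \<in> T. y \<in> A t})" using lower by (rule sum_mono)
  also have "\<dots> = (\<Sum>t\<in>T. card (A t))"
    by (rule sum_card_double_count[symmetric, OF finT E(2) AM(2)])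
  finally have le: "(\<Sum>t\<in>T. k * card (bdry 1 (A t))) \<le> (\<Sum>t\<in>T. card (A t))"
    by (simp add: sum_distrib_left)
  have "T \<noteq> {}"
  proof -
    obtain y where "y \<in> E" using E_bdry by fastforce
    then have "{t \<in> T. y \<in> A t} \<noteq> {}" using lower[of y] r(2) by (metis card.empty not_le)
    then show ?thesis by blast
  qed
  \<comment> \<open>If every triple failed, summing the strict inequalities over the nonempty
    \<open>T\<close> would contradict \<open>le\<close>.\<close>
  then obtain t where t: "t \<in> T" "k * card (bdry 1 (A t)) \<le> card (A t)"
    using le sum_strict_mono[OF finT] by (meson not_le)
  obtain i U s where "t = (i, U, s)" by (cases t) auto
  then show thesis
    using t that[of i U s] bY[of t] finY finite_subset by (auto simp: T_def A_def)
qed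

text \<open>A set within \<open>s < r\<close> of a piece at scale \<open>2 * r\<close> has diameter
  at most \<open>\<tau> (2 * r) + 2 * r\<close>; here
  \<open>2 * r = 4 * (n + 1) * k\<close>.\<close>

lemma isodiam_le_FAD:
  assumes cg: "coarsely_geodesic" and am: "amenable" and FAD: "FAD n \<tau>" and k: "k > 0"
  shows "isodiam k \<le> \<tau> (4 * (n + 1) * k) + 4 * (n + 1) * k"
proof -
  define r where "r = 2 * (n + 1) * k"
  have r: "r > 0" "2 * r = 4 * (n + 1) * k" using k by (auto simp: r_def algebra_simps)
  \<comment> \<open>Amenability is applied with radius 1 and
    \<open>\<epsilon> = 1 / r\<close>.\<close>
  obtain E where E: "E \<subseteq> M" "finite E" "finite (bdry 1 E)"
    and "real (card (bdry 1 E)) < 1 / real r * real (card E)"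
    using am r unfolding amenable_def by (metis of_nat_0_less_iff zero_less_divide_1_iff zero_less_one)
  then have "real (r * card (bdry 1 E)) < real (card E)"
    using r(1) by (simp add: field_simps)
  then have E_bdry: "r * card (bdry 1 E) < card E" using of_nat_less_iff by blast
  obtain P where cover: "M = (\<Union>i\<in>{1..n+1}. \<Union> (P i))"
    and sep: "\<And>i U V u v. \<lbrakk>i \<in> {1..n+1}; U \<in> P i; V \<in> P i; U \<noteq> V; u \<in> U; v \<in> V\<rbrakk>
      \<Longrightarrow> d u v > real (2 * r)"
    and diam: "\<And>i U u v. \<lbrakk>i \<in> {1..n+1}; U \<in> P i; u \<in> U; v \<in> U\<rbrakk>
      \<Longrightarrow> d u v \<le> real (\<tau> (2 * r))"
    using FAD_pieces[OF FAD, of "2 * r"] by blast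
  obtain i U s where iU: "i \<in> {1..n+1}" "U \<in> P i" "s < r" "set_nbhd (real s) U \<inter> E \<noteq> {}"
    and bdry: "finite (bdry 1 (set_nbhd (real s) U \<inter> E))"
      "k * card (bdry 1 (set_nbhd (real s) U \<inter> E)) \<le> card (set_nbhd (real s) U \<inter> E)"
    using exists_Folner_piece[OF cg E E_bdry eq_refl[OF r_def[symmetric]] r(1) cover sep] .
  have UM: "U \<subseteq> M" using iU cover by blast
  have "isodiam k \<le> \<tau> (2 * r) + 2 * r"
  proof (rule isodiam_le[OF cg])
    fix x y assume "x \<in> set_nbhd (real s) U \<inter> E" "y \<in> set_nbhd (real s) U \<inter> E"
    then obtain u v where uv: "x \<in> M" "y \<in> M" "u \<in> U" "v \<in> U" "d x u \<le> real s" "d y v \<le> real s"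
      by (auto simp: mem_set_nbhd_iff[OF cg UM])
    have "d u v \<le> real (\<tau> (2 * r))"
      using diam iU uv by blast
    moreover have "d x y \<le> d x u + d u v + d y v"
      using triangle[of x u y] triangle[of u v y] commute[of v y] uv UM by force
    ultimately show "d x y \<le> real (\<tau> (2 * r) + 2 * r)"
      using uv iU(3) by simp
  next
    have "real k * real (card (bdry 1 (set_nbhd (real s) U \<inter> E)))
        \<le> real (card (set_nbhd (real s) U \<inter> E))"
      using bdry(2) by (metis of_nat_le_iff of_nat_mult)
    then show "finite (bdry 1 (set_nbhd (real s) U \<inter> E)) \<and>
      real (card (bdry 1 (set_nbhd (real s) U \<inter> E)))
        \<le> 1 / real k * real (card (set_nbhd (real s) U \<inter> E))"
      using bdry(1) k by (simp add: field_simps)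
  qed (use E iU in auto)
  then show ?thesis by (simp add: r(2))
qed

end

section \<open>Comparison of growth on finite and infinite spaces\<close>

text \<open>\<open>nondegenerate\<close> excludes cases such as two points at distance 1 with
  \<open>n = 1\<close> and \<open>\<tau> = 0\<close>: singletons give the decomposition, yet
  \<open>isodiam 2 = 1\<close>. For infinite spaces \<open>FAD_linear_lower_bound\<close> already
  makes \<open>\<tau>\<close> nonzero somewhere.\<close>

theorem corollary5p8:
  fixes X :: "'a set" and d :: "'a \<Rightarrow> 'a \<Rightarrow> real" and n :: nat and \<tau> :: "nat \<Rightarrow> nat"
  assumes "Metric_space X d"
    and "Metric_space.coarsely_geodesic X d"
    and "Metric_space.amenable X d"
    and "Metric_space.bounded_geometry X d"
    and "mono \<tau>"
    and "Metric_space.FAD X d n \<tau>"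
    and nondegenerate: "is_singleton X \<or> (\<exists>R. \<tau> R \<noteq> 0)"
  shows "Metric_space.isodiam X d \<preceq> \<tau>"
proof -
  interpret Metric_space X d by fact
  \<comment> \<open>The strict inequality in \<open>amenable\<close> rules out an empty
    \<open>E\<close>.\<close>
  have ne: "X \<noteq> {}"
    using assms(3) unfolding amenable_def
    by (metis card.empty finite.emptyI mult_zero_right not_less of_nat_0 of_nat_0_le_iff
        subset_empty zero_less_one)
  have iso0: "isodiam 0 = 0" using isodiam_0 assms(2) ne by blast
  show ?thesis
  proof (cases "finite X")
    case True
    consider x where "X = {x}" | R where "\<tau> R \<noteq> 0"
      using nondegenerate by (auto simp: is_singleton_def)
    then show ?thesis
    proof cases
      case 1
      then have "isodiam k \<le> 0" for k
        using isodiam_le_diam_finite_space[OF assms(2) True ne, of 0 k] by simp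
      then show ?thesis unfolding growth_le_def by (intro exI[of _ 1] conjI) auto
    next
      case 2
      obtain D where D: "\<And>x y. x \<in> X \<Longrightarrow> y \<in> X \<Longrightarrow> d x y \<le> real D"
      proof -
        have "finite ((\<lambda>(x, y). d x y) ` (X \<times> X))" using True by simp
        then obtain B where "\<And>x y. x \<in> X \<Longrightarrow> y \<in> X \<Longrightarrow> d x y \<le> B"
          using bdd_above_finite unfolding bdd_above_def by fastforce
        moreover obtain D where "B \<le> real D" using real_arch_simple by blast
        ultimately show thesis using that order_trans by metis
      qed
      \<comment> \<open>For \<open>k > 0\<close> the factor \<open>Suc R\<close> pushes the argument
        beyond \<open>R\<close>, where \<open>\<tau>\<close> is at least 1 by monotonicity. The
        successors keep both constants positive when \<open>D\<close> or \<open>R\<close> is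
        0.\<close>
      have "real (isodiam k) \<le> real (Suc D) * real (\<tau> (Suc R * k))" for k
      proof (cases "k = 0")
        case False
        then have "R \<le> Suc R * k" by (cases k) auto
        then have "\<tau> R \<le> \<tau> (Suc R * k)" using \<open>mono \<tau>\<close> by (simp add: monoD)
        then have \<tau>: "1 \<le> \<tau> (Suc R * k)" using 2 by simp
        have "isodiam k \<le> D"
          using isodiam_le_diam_finite_space[OF assms(2) True ne D] by blast
        also have "\<dots> \<le> Suc D * \<tau> (Suc R * k)"
          using mult_le_mono[of D "Suc D" 1, OF _ \<tau>] by simp
        finally show ?thesis by (metis of_nat_le_iff of_nat_mult)
      qed (simp add: iso0)
      then show ?thesis
        unfolding growth_le_def by (intro exI[of _ "real (Suc D)"] exI[of _ "Suc R"] conjI) auto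
    qed
  next
    case False
    \<comment> \<open>With this \<open>q\<close>, the scale in \<open>isodiam_le_FAD\<close> is
      exactly \<open>q * k\<close>.\<close>
    define q where "q = 4 * (n + 1)"
    have "real (isodiam k) \<le> real (1 + q) * real (\<tau> (q * k))" for k
    proof (cases "k = 0")
      case k: False
      \<comment> \<open>Cancelling \<open>n + 1\<close> leaves
        \<open>k \<le> \<tau> (q * k)\<close>, so the additive term \<open>q * k\<close> is at most
        \<open>q * \<tau> (q * k)\<close>; hence the constant \<open>1 + q\<close>.\<close>
      have "q * k + 1 \<le> (n + 1) * (\<tau> (q * k) + 1)"
        using FAD_linear_lower_bound[OF assms(2,4) False assms(6)] .
      then have "(n + 1) * (4 * k) < (n + 1) * (\<tau> (q * k) + 1)"
        by (simp add: q_def algebra_simps)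
      then have "4 * k < \<tau> (q * k) + 1" by (metis mult_less_cancel1)
      then have "k \<le> \<tau> (q * k)" by simp
      then have "q * k \<le> q * \<tau> (q * k)" by (rule mult_le_mono2)
      moreover have "isodiam k \<le> \<tau> (q * k) + q * k"
        using isodiam_le_FAD[OF assms(2,3,6)] k by (simp add: q_def)
      ultimately have "isodiam k \<le> (1 + q) * \<tau> (q * k)" by (simp only: distrib_right mult_1)
      then show ?thesis by (metis of_nat_le_iff of_nat_mult)
    qed (simp add: iso0)
    then show ?thesis
      unfolding growth_le_def
      by (intro exI[of _ "real (1 + q)"] exI[of _ q] conjI) (auto simp: q_def)
  qed
qed

end
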